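(* Let $n\geq 2$, let $M_0$ be a simple matroid on a ground set $E_0$ disjoint from $[n]$, fix $\epsilon_0\in E_0$, and let $M=C_n\oplus M_0$ and $M'=P^n_{\epsilon_0}\oplus S$. Then $$T_M(x,y)=\Bigl(\sum_{i=1}^{n-1}x^i+y\Bigr)T_{M_0}(x,y)$$ and $$T_{M'}(x,y)=\Bigl(\sum_{i=1}^{n-1}x^i\Bigr)T_{M_0}(x,y)+xy\,T_{M_0/\epsilon_0}(x,y).$$
   Context: $T_N(x,y)$ is the Tutte polynomial of a matroid $N$, and $M_0/\epsilon_0$ is the contraction of $M_0$ by $\epsilon_0$. $C_n$ is the matroid on $[n]=\{1,\dots,n\}$ of rank $n-1$ whose only circuit is $[n]$; $S$ is the rank-one matroid on a single point $p$; $\oplus$ is direct sum. The parallel connection $P^n_{\epsilon_0}$: on $[n]\cup E_0$ identify $1$ with $\epsilon_0$ (other classes singletons), write $\bar q$ for the class of $q$, $\bar X$ for the set of classes of elements of $X$, $\bar E$ for the set of classes; $P^n_{\epsilon_0}$ is the matroid on $\bar E$ whose circuits are the $\bar C$ with $C$ a circuit of $C_n$ or of $M_0$, together with the sets $\overline{C-1}\cup\overline{C'-\epsilon_0}$ with $1\in C$ a circuit of $C_n$ and $\epsilon_0\in C'$ a circuit of $M_0$. *)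

theory Defs
  imports "HOL-Computational_Algebra.Polynomial"
begin

record 'a indep_system =
  ground :: "'a set"
  indep :: "'a set \<Rightarrow> bool"

locale matroid =
  fixes M :: "'a indep_system"
  assumes finite_ground: "finite (ground M)"
    and indep_subset_ground: "indep M I \<Longrightarrow> I \<subseteq> ground M"
    and indep_empty: "indep M {}"
    and indep_mono: "indep M J \<Longrightarrow> I \<subseteq> J \<Longrightarrow> indep M I"
    and indep_augment: "indep M I \<Longrightarrow> indep M J \<Longrightarrow> card I < card J \<Longrightarrow>
      \<exists>e\<in>J - I. indep M (insert e I)"

definition circuits :: "'a indep_system \<Rightarrow> 'a set set" where
  "circuits M = {C. C \<subseteq> ground M \<and> \<not> indep M C \<and> (\<forall>D. D \<subset> C \<longrightarrow> indep M D)}"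

definition rank :: "'a indep_system \<Rightarrow> 'a set \<Rightarrow> nat" where
  "rank M A = Max (card ` {I. I \<subseteq> A \<and> indep M I})"

text \<open>No loops and no pairs of parallel elements.\<close>

definition simple :: "'a indep_system \<Rightarrow> bool" where
  "simple M \<longleftrightarrow> (\<forall>e. {e} \<notin> circuits M) \<and> (\<forall>e f. e \<noteq> f \<longrightarrow> {e, f} \<notin> circuits M)"

text \<open>Contracting a loop is the same as deleting it.\<close>

definition contract :: "'a indep_system \<Rightarrow> 'a \<Rightarrow> 'a indep_system" where
  "contract M e =
    \<lparr>ground = ground M - {e},
     indep = (\<lambda>I. I \<subseteq> ground M - {e} \<and> indep M (if indep M {e} then insert e I else I))\<rparr>"

text \<open>The direct sum lives on the tagged union of the two ground sets, so that the summands
  are disjoint by construction.\<close>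

definition direct_sum :: "'a indep_system \<Rightarrow> 'b indep_system \<Rightarrow> ('a + 'b) indep_system"
    (infixr "\<oplus>\<^sub>M" 65) where
  "M \<oplus>\<^sub>M N =
    \<lparr>ground = ground M <+> ground N,
     indep = (\<lambda>I. \<exists>J K. indep M J \<and> indep N K \<and> I = J <+> K)\<rparr>"

text \<open>The Tutte polynomial is an element of \<open>\<int>[y][x]\<close>, with \<open>x\<close> the outer variable. It is given by
  its corank-nullity expansion; for a matroid the truncated subtractions in the exponents
  are exact.\<close>

definition var_x :: "int poly poly" where
  "var_x = [:0, 1:]"

definition var_y :: "int poly poly" where
  "var_y = [:[:0, 1:]:]"

definition tutte :: "'a indep_system \<Rightarrow> int poly poly" where
  "tutte M = (\<Sum>A\<in>Pow (ground M).
     (var_x - 1) ^ (rank M (ground M) - rank M A) * (var_y - 1) ^ (card A - rank M A))"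

text \<open>If \<open>\<C>\<close> is the set of circuits of a matroid on \<open>E\<close>, this is that matroid.\<close>

definition of_circuits :: "'a set \<Rightarrow> 'a set set \<Rightarrow> 'a indep_system" where
  "of_circuits E \<C> = \<lparr>ground = E, indep = (\<lambda>I. I \<subseteq> E \<and> (\<forall>C\<in>\<C>. \<not> C \<subseteq> I))\<rparr>"

lemma circuits_of_circuits:
  assumes "\<And>C. C \<in> \<C> \<Longrightarrow> C \<subseteq> E" "\<And>C D. C \<in> \<C> \<Longrightarrow> D \<in> \<C> \<Longrightarrow> C \<subseteq> D \<Longrightarrow> C = D"
  shows "circuits (of_circuits E \<C>) = \<C>"
proof (intro equalityI subsetI)
  fix C assume "C \<in> circuits (of_circuits E \<C>)"
  then have C: "C \<subseteq> E" "\<exists>D\<in>\<C>. D \<subseteq> C" "\<And>D D'. D \<subset> C \<Longrightarrow> D' \<in> \<C> \<Longrightarrow> \<not> D' \<subseteq> D"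
    by (auto simp: circuits_def of_circuits_def)
  then show "C \<in> \<C>" by (metis psubsetI subset_refl)
next
  fix C assume "C \<in> \<C>"
  then show "C \<in> circuits (of_circuits E \<C>)"
    using assms by (fastforce simp: circuits_def of_circuits_def)
qed

definition cycle_matroid :: "nat \<Rightarrow> nat indep_system" where
  "cycle_matroid n = of_circuits {1..n} {{1..n}}"

lemma circuits_cycle_matroid: "circuits (cycle_matroid n) = {{1..n}}"
  unfolding cycle_matroid_def by (rule circuits_of_circuits) auto

lemma rank_cycle_matroid:
  assumes "n \<ge> 1"
  shows "rank (cycle_matroid n) {1..n} = n - 1"
  unfolding rank_def
proof (rule Max_eqI)
  show "finite (card ` {I. I \<subseteq> {1..n} \<and> indep (cycle_matroid n) I})"
    by (rule finite_imageI, rule finite_subset[of _ "Pow {1..n}"]) auto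
next
  fix k assume "k \<in> card ` {I. I \<subseteq> {1..n} \<and> indep (cycle_matroid n) I}"
  then obtain I where "k = card I" "I \<subset> {1..n}"
    by (auto simp: cycle_matroid_def of_circuits_def)
  then show "k \<le> n - 1"
    using psubset_card_mono[of "{1..n}" I] by simp
next
  have "\<not> {1..n} \<subseteq> {1..n - 1}" using assms by (auto simp: subset_iff)
  then have "{1..n - 1} \<in> {I. I \<subseteq> {1..n} \<and> indep (cycle_matroid n) I}"
    by (auto simp: cycle_matroid_def of_circuits_def)
  then show "n - 1 \<in> card ` {I. I \<subseteq> {1..n} \<and> indep (cycle_matroid n) I}"
    by (metis card_atLeastAtMost diff_Suc_1 imageI)
qed

text \<open>The matroid of rank one on the single point \<open>p\<close>.\<close>

definition point_matroid :: "'a \<Rightarrow> 'a indep_system" where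
  "point_matroid p = \<lparr>ground = {p}, indep = (\<lambda>I. I \<subseteq> {p})\<rparr>"

definition identify :: "nat \<Rightarrow> 'a indep_system \<Rightarrow> 'a \<Rightarrow> ((nat + 'a) \<times> (nat + 'a)) set" where
  "identify n M\<^sub>0 \<epsilon>\<^sub>0 =
    Id_on ({1..n} <+> ground M\<^sub>0) \<union> {(Inl 1, Inr \<epsilon>\<^sub>0), (Inr \<epsilon>\<^sub>0, Inl 1)}"

lemma equiv_identify:
  assumes "n \<ge> 1" "\<epsilon>\<^sub>0 \<in> ground M\<^sub>0"
  shows "equiv ({1..n} <+> ground M\<^sub>0) (identify n M\<^sub>0 \<epsilon>\<^sub>0)"
  using assms by (auto simp: equiv_def refl_on_def sym_def trans_def identify_def Id_on_def)

text \<open>\<open>classes n M\<^sub>0 \<epsilon>\<^sub>0 X\<close> is the set of classes of the elements of \<open>X\<close>.\<close>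

definition classes :: "nat \<Rightarrow> 'a indep_system \<Rightarrow> 'a \<Rightarrow> (nat + 'a) set \<Rightarrow> (nat + 'a) set set" where
  "classes n M\<^sub>0 \<epsilon>\<^sub>0 X = (\<lambda>q. identify n M\<^sub>0 \<epsilon>\<^sub>0 `` {q}) ` X"

definition parallel_circuits :: "nat \<Rightarrow> 'a indep_system \<Rightarrow> 'a \<Rightarrow> (nat + 'a) set set set" where
  "parallel_circuits n M\<^sub>0 \<epsilon>\<^sub>0 =
     {classes n M\<^sub>0 \<epsilon>\<^sub>0 (Inl ` C) | C. C \<in> circuits (cycle_matroid n)} \<union>
     {classes n M\<^sub>0 \<epsilon>\<^sub>0 (Inr ` C) | C. C \<in> circuits M\<^sub>0} \<union>
     {classes n M\<^sub>0 \<epsilon>\<^sub>0 (Inl ` (C - {1})) \<union> classes n M\<^sub>0 \<epsilon>\<^sub>0 (Inr ` (C' - {\<epsilon>\<^sub>0})) | C C'.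
        C \<in> circuits (cycle_matroid n) \<and> 1 \<in> C \<and> C' \<in> circuits M\<^sub>0 \<and> \<epsilon>\<^sub>0 \<in> C'}"

definition parallel_connection :: "nat \<Rightarrow> 'a indep_system \<Rightarrow> 'a \<Rightarrow> (nat + 'a) set indep_system" where
  "parallel_connection n M\<^sub>0 \<epsilon>\<^sub>0 =
     of_circuits (({1..n} <+> ground M\<^sub>0) // identify n M\<^sub>0 \<epsilon>\<^sub>0) (parallel_circuits n M\<^sub>0 \<epsilon>\<^sub>0)"

lemma circuits_parallel_connection:
  assumes "n \<ge> 2" "matroid M\<^sub>0" "simple M\<^sub>0" "\<epsilon>\<^sub>0 \<in> ground M\<^sub>0"
  shows "circuits (parallel_connection n M\<^sub>0 \<epsilon>\<^sub>0) = parallel_circuits n M\<^sub>0 \<epsilon>\<^sub>0"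
proof -
  define b where "b q = identify n M\<^sub>0 \<epsilon>\<^sub>0 `` {q}" for q
  have sub: "C \<subseteq> ground M\<^sub>0" if "C \<in> circuits M\<^sub>0" for C
    using that by (auto simp: circuits_def)
  have anti: "C = D" if "C \<in> circuits M\<^sub>0" "D \<in> circuits M\<^sub>0" "C \<subseteq> D" for C D
    using that by (auto simp: circuits_def)
  have small: "\<not> C \<subseteq> {\<epsilon>\<^sub>0}" if "C \<in> circuits M\<^sub>0" for C
    using that assms(3) matroid.indep_empty[OF assms(2)]
    by (auto simp: simple_def circuits_def subset_singleton_iff)
  have b1: "b (Inl 1) = b (Inr \<epsilon>\<^sub>0)"
    using assms by (auto simp: b_def identify_def)
  have bR: "b (Inr e) = b (Inr f) \<longleftrightarrow> e = f" if "e \<in> ground M\<^sub>0" "f \<in> ground M\<^sub>0" for e f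
    using that by (auto simp: b_def identify_def set_eq_iff)
  have bL: "b (Inl i) \<noteq> b (Inr f)" "b (Inr f) \<noteq> b (Inl i)" if "i \<in> {1..n} - {1}" "f \<in> ground M\<^sub>0" for i f
    using that by (auto simp: b_def identify_def set_eq_iff)
  define A where "A = insert (b (Inr \<epsilon>\<^sub>0)) ((\<lambda>i. b (Inl i)) ` ({1..n} - {1}))"
  define B where "B C = (\<lambda>e. b (Inr e)) ` C" for C
  define U where "U C = (\<lambda>i. b (Inl i)) ` ({1..n} - {1}) \<union> B (C - {\<epsilon>\<^sub>0})" for C
  have A_eq: "classes n M\<^sub>0 \<epsilon>\<^sub>0 (Inl ` {1..n}) = A"
  proof -
    have "{1..n} = insert 1 ({1..n} - {1})" using assms(1) by auto
    then have "(\<lambda>i. b (Inl i)) ` {1..n} = A"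
      unfolding A_def b1[symmetric] by (metis image_insert)
    then show ?thesis by (simp add: classes_def image_image b_def)
  qed
  have pc: "parallel_circuits n M\<^sub>0 \<epsilon>\<^sub>0 =
      {A} \<union> B ` circuits M\<^sub>0 \<union> U ` {C \<in> circuits M\<^sub>0. \<epsilon>\<^sub>0 \<in> C}"
  proof -
    have cB: "classes n M\<^sub>0 \<epsilon>\<^sub>0 (Inr ` C) = B C" for C
      by (simp add: classes_def image_image b_def B_def)
    have cL: "classes n M\<^sub>0 \<epsilon>\<^sub>0 (Inl ` X) = (\<lambda>i. b (Inl i)) ` X" for X
      by (simp add: classes_def image_image b_def)
    have one: "1 \<in> {1..n}" using assms(1) by simp
    have "{(\<lambda>i. b (Inl i)) ` C | C. C \<in> {{1..n}}} = {A}"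
      using A_eq unfolding cL by blast
    moreover have "{B C | C. C \<in> circuits M\<^sub>0} = B ` circuits M\<^sub>0"
      by blast
    moreover have "{(\<lambda>i. b (Inl i)) ` (C - {1}) \<union> B (C' - {\<epsilon>\<^sub>0}) | C C'.
        C \<in> {{1..n}} \<and> 1 \<in> C \<and> C' \<in> circuits M\<^sub>0 \<and> \<epsilon>\<^sub>0 \<in> C'} =
        U ` {C \<in> circuits M\<^sub>0. \<epsilon>\<^sub>0 \<in> C}"
      using one unfolding U_def by blast
    ultimately show ?thesis
      unfolding parallel_circuits_def circuits_cycle_matroid cB cL by (simp only:)
  qed
  have two: "2 \<in> {1..n} - {1}" using assms(1) by auto
  define pre where "pre X = {e \<in> ground M\<^sub>0. b (Inr e) \<in> X}" for X
  have pre_mono: "pre X \<subseteq> pre Y" if "X \<subseteq> Y" for X Y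
    using that by (auto simp: pre_def)
  have notL: "b (Inr e) \<notin> (\<lambda>i. b (Inl i)) ` ({1..n} - {1})" if "e \<in> ground M\<^sub>0" for e
    using bL(2)[OF _ that] by (auto simp del: atLeastAtMost_iff)
  have pre_B: "pre (B C) = C" if "C \<subseteq> ground M\<^sub>0" for C
    using that bR by (auto simp: pre_def B_def)
  have pre_A: "pre A = {\<epsilon>\<^sub>0}"
    using bR assms(4) notL unfolding A_def pre_def by blast
  have pre_U: "pre (U C) = C - {\<epsilon>\<^sub>0}" if "C \<subseteq> ground M\<^sub>0" for C
  proof -
    have "pre (U C) = pre (B (C - {\<epsilon>\<^sub>0}))"
      using notL unfolding U_def pre_def by blast
    then show ?thesis using pre_B[of "C - {\<epsilon>\<^sub>0}"] that by blast
  qed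
  have two_B: "b (Inl 2) \<notin> B C" if "C \<subseteq> ground M\<^sub>0" for C
    using that bL(1)[OF two] by (auto simp: B_def)
  have two_A: "b (Inl 2) \<in> A" and two_U: "b (Inl 2) \<in> U C" for C
    using two unfolding A_def U_def by blast+
  have AB: "\<not> A \<subseteq> B C" and UB: "\<not> U D \<subseteq> B C" if "C \<in> circuits M\<^sub>0" for C D
    using two_A two_U[of D] two_B[OF sub[OF that]] by blast+
  have AU: "\<not> A \<subseteq> U C" if "C \<in> circuits M\<^sub>0" for C
    using pre_mono[of A "U C"] unfolding pre_A pre_U[OF sub[OF that]] by blast
  have BA: "\<not> B C \<subseteq> A" if "C \<in> circuits M\<^sub>0" for C
    using pre_mono[of "B C" A] small[OF that] unfolding pre_A pre_B[OF sub[OF that]] by blast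
  have UA: "\<not> U C \<subseteq> A" if "C \<in> circuits M\<^sub>0" for C
    using pre_mono[of "U C" A] small[OF that] unfolding pre_A pre_U[OF sub[OF that]] by blast
  have BB: "C = D" if "C \<in> circuits M\<^sub>0" "D \<in> circuits M\<^sub>0" "B C \<subseteq> B D" for C D
    using pre_mono[OF that(3)] anti[OF that(1,2)]
    unfolding pre_B[OF sub[OF that(1)]] pre_B[OF sub[OF that(2)]] by blast
  have BU: "\<not> B C \<subseteq> U D" if "C \<in> circuits M\<^sub>0" "D \<in> circuits M\<^sub>0" "\<epsilon>\<^sub>0 \<in> D" for C D
    using pre_mono[of "B C" "U D"] anti[OF that(1,2)] that(3)
    unfolding pre_B[OF sub[OF that(1)]] pre_U[OF sub[OF that(2)]] by blast
  have UU: "C = D" if "C \<in> circuits M\<^sub>0" "D \<in> circuits M\<^sub>0" "\<epsilon>\<^sub>0 \<in> D" "U C \<subseteq> U D" for C D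
    using pre_mono[OF that(4)] anti[OF that(1,2)] that(3)
    unfolding pre_U[OF sub[OF that(1)]] pre_U[OF sub[OF that(2)]] by blast
  show ?thesis
    unfolding parallel_connection_def
  proof (rule circuits_of_circuits)
    fix C assume "C \<in> parallel_circuits n M\<^sub>0 \<epsilon>\<^sub>0"
    then have "C \<subseteq> b ` ({1..n} <+> ground M\<^sub>0)"
      unfolding pc using sub assms(4) by (auto simp: A_def B_def U_def)
    then show "C \<subseteq> ({1..n} <+> ground M\<^sub>0) // identify n M\<^sub>0 \<epsilon>\<^sub>0"
      by (auto simp: quotient_def b_def)
  next
    fix C D assume "C \<in> parallel_circuits n M\<^sub>0 \<epsilon>\<^sub>0" "D \<in> parallel_circuits n M\<^sub>0 \<epsilon>\<^sub>0" "C \<subseteq> D"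
    then show "C = D"
      unfolding pc by (auto dest: AB UB AU BA UA BB BU UU)
  qed
qed

end

theory Submission
  imports Defs
begin

text \<open>Everything is read off the corank-nullity expansion. Write a subset of the ground set of
  the parallel connection as \<open>L \<union> B\<close> with \<open>L \<subseteq> {2..n}\<close> and \<open>B \<subseteq> E\<^sub>0\<close>. Its rank is \<open>|L| + r(B)\<close> if \<open>L\<close> is proper and
  \<open>n - 2 + r(B \<union> \<epsilon>\<^sub>0)\<close> if \<open>L = {2..n}\<close>. The proper \<open>L\<close> contribute \<open>1 + x + \<dots> + x\<^bsup>n-2\<^esup>\<close> times the
  polynomial of \<open>M\<^sub>0\<close>, and for \<open>L = {2..n}\<close> pairing \<open>B\<close> with \<open>B \<union> \<epsilon>\<^sub>0\<close> gives \<open>1 + (y - 1) = y\<close> times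
  the polynomial of the contraction.\<close>

section \<open>Rank in finite set systems\<close>

text \<open>This is enough for the maximum in \<open>rank\<close> to be attained, for rank to be
  monotone, and for rank to be at most cardinality on finite sets, which makes the truncated
  exponents in \<open>tutte\<close> exact. Set systems given by circuits thus enter the Tutte
  computations directly.\<close>

locale independence_system =
  fixes M :: "'a indep_system"
  assumes finite_ground: "finite (ground M)"
    and indep_subset_ground: "indep M I \<Longrightarrow> I \<subseteq> ground M"
    and indep_empty: "indep M {}"
begin

lemma finite_indep_sets: "finite {I. I \<subseteq> A \<and> indep M I}"
  by (rule finite_subset[of _ "Pow (ground M)"]) (auto simp: finite_ground dest: indep_subset_ground)

lemma card_le_rank:
  assumes "indep M I" "I \<subseteq> A"
  shows "card I \<le> rank M A"
  unfolding rank_def using assms finite_indep_sets by (intro Max_ge) auto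

lemma rank_witness:
  obtains I where "I \<subseteq> A" "indep M I" "card I = rank M A"
proof -
  have "rank M A \<in> card ` {I. I \<subseteq> A \<and> indep M I}"
    unfolding rank_def using finite_indep_sets indep_empty by (intro Max_in) auto
  then show ?thesis using that by auto
qed

lemma rank_mono: "A \<subseteq> B \<Longrightarrow> rank M A \<le> rank M B"
  by (metis rank_witness card_le_rank order_trans)

lemma rank_le_card: "finite A \<Longrightarrow> rank M A \<le> card A"
  by (metis rank_witness card_mono)

lemma rank_eqI:
  assumes "\<And>I. I \<subseteq> A \<Longrightarrow> indep M I \<Longrightarrow> card I \<le> k" "I \<subseteq> A" "indep M I" "card I = k"
  shows "rank M A = k"
  using assms by (metis rank_witness card_le_rank order_antisym)

end

sublocale matroid \<subseteq> independence_system
  by unfold_locales (auto intro: finite_ground indep_empty dest: indep_subset_ground)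

text \<open>An injective relabelling keeps cardinalities and matches the independent subsets of A
  with those of its image, so ranks agree and the expansion is reindexed over the power set. It
  serves to replace classes by representatives.\<close>

lemma tutte_iso:
  assumes f: "bij_betw f (ground M) (ground N)"
    and indep: "\<And>I. I \<subseteq> ground M \<Longrightarrow> indep N (f ` I) \<longleftrightarrow> indep M I"
  shows "tutte N = tutte M"
proof -
  have inj: "inj_on f A" if "A \<subseteq> ground M" for A
    using f that by (meson bij_betw_def inj_on_subset)
  have rank: "rank N (f ` A) = rank M A" if "A \<subseteq> ground M" for A
  proof -
    have "{I. I \<subseteq> f ` A \<and> indep N I} = (`) f ` {I. I \<subseteq> A \<and> indep M I}"
      using indep that by (auto simp: subset_image_iff)
    moreover have "card (f ` I) = card I" if "I \<subseteq> A" for I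
      using inj[of I] \<open>A \<subseteq> ground M\<close> that by (intro card_image) auto
    ultimately have "card ` {I. I \<subseteq> f ` A \<and> indep N I} = card ` {I. I \<subseteq> A \<and> indep M I}"
      by (auto simp: image_image intro!: image_cong)
    then show ?thesis unfolding rank_def by simp
  qed
  have g: "ground N = f ` ground M"
    using f by (simp add: bij_betw_def)
  show ?thesis
    unfolding tutte_def
    by (subst sum.reindex_bij_betw[OF bij_betw_Pow[OF f], symmetric], rule sum.cong)
      (auto simp: g rank card_image[OF inj])
qed

section \<open>Disjoint unions and sums over power sets\<close>

lemma inj_on_image_subset_iff:
  assumes "inj_on f C" "A \<subseteq> C" "B \<subseteq> C"
  shows "f ` A \<subseteq> f ` B \<longleftrightarrow> A \<subseteq> B"
  \<comment> \<open>Inclusion becomes the equation \<open>A \<union> B = B\<close>, so that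
    injectivity can be applied to equal images.\<close>
  unfolding subset_Un_eq[of "f ` A"] subset_Un_eq[of A] image_Un[symmetric]
  using assms by (intro inj_on_image_eq_iff) auto

lemma Plus_subset_Plus_iff: "A <+> B \<subseteq> C <+> D \<longleftrightarrow> A \<subseteq> C \<and> B \<subseteq> D"
  by auto

lemma subset_PlusE:
  assumes "I \<subseteq> A <+> B"
  obtains J K where "I = J <+> K" "J \<subseteq> A" "K \<subseteq> B"
proof -
  have "I = (Inl -` I) <+> (Inr -` I)" using assms by auto
  then show ?thesis using assms by (intro that[of "Inl -` I" "Inr -` I"]) auto
qed

lemma Plus_eq_iff: "A <+> B = C <+> D \<longleftrightarrow> A = C \<and> B = D"
  by (metis Plus_subset_Plus_iff subset_antisym subset_refl)

lemma bij_betw_Plus_Pow: "bij_betw (\<lambda>(A, B). A <+> B) (Pow E \<times> Pow F) (Pow (E <+> F))"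
proof (rule bij_betwI')
  fix I assume "I \<in> Pow (E <+> F)"
  then obtain J K where "I = J <+> K" "J \<subseteq> E" "K \<subseteq> F"
    by (auto elim: subset_PlusE)
  then show "\<exists>x\<in>Pow E \<times> Pow F. I = (case x of (A, B) \<Rightarrow> A <+> B)"
    by (intro bexI[of _ "(J, K)"]) auto
qed (auto simp: Plus_eq_iff)

lemma sum_Pow_Plus:
  "(\<Sum>A\<in>Pow (E <+> F). f A) = (\<Sum>A\<in>Pow E. \<Sum>B\<in>Pow F. f (A <+> B))"
  by (subst sum.reindex_bij_betw[OF bij_betw_Plus_Pow, symmetric])
    (simp add: sum.cartesian_product split_def)

lemma sum_Pow_insert:
  assumes "finite S" "a \<notin> S"
  shows "(\<Sum>A\<in>Pow (insert a S). f A) = (\<Sum>A\<in>Pow S. f A) + (\<Sum>A\<in>Pow S. f (insert a A))"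
proof -
  have "inj_on (insert a) (Pow S)"
    using assms(2) by (auto simp: inj_on_def)
  then show ?thesis
    unfolding Pow_insert using assms by (subst sum.union_disjoint) (auto simp: sum.reindex)
qed

text \<open>The binomial expansion of \<open>((x - 1) + 1) ^ card S\<close>, indexed by complements
  of subsets.\<close>

lemma sum_Pow_power_diff_card:
  fixes x :: "'a::comm_ring_1"
  assumes "finite S"
  shows "(\<Sum>A\<in>Pow S. (x - 1) ^ (card S - card A)) = x ^ card S"
  using assms
proof (induction S rule: finite_induct)
  case (insert a S)
  have fin: "finite A" "a \<notin> A" "card A \<le> card S" if "A \<in> Pow S" for A
    using that insert by (auto intro: card_mono finite_subset)
  have "(\<Sum>A\<in>Pow (insert a S). (x - 1) ^ (card (insert a S) - card A)) =
      (\<Sum>A\<in>Pow S. (x - 1) * (x - 1) ^ (card S - card A)) +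
      (\<Sum>A\<in>Pow S. (x - 1) ^ (card S - card A))"
    using insert fin
    by (simp add: sum_Pow_insert Suc_diff_le)
  also have "\<dots> = (x - 1) * x ^ card S + x ^ card S"
    using insert by (simp add: sum_distrib_left[symmetric])
  finally show ?case
    using insert by (simp add: algebra_simps)
qed simp

text \<open>Formally this is \<open>(x ^ card S - 1) / (x - 1)\<close>, a geometric sum. Induction
  avoids the division: proper subsets of \<open>insert a S\<close> are all subsets of S, which yield
  the new power \<open>x ^ card S\<close>, and the proper subsets of S with a added.\<close>

lemma sum_psubsets_power_diff_card:
  fixes x :: "'a::comm_ring_1"
  assumes "finite S"
  shows "(\<Sum>A\<in>Pow S - {S}. (x - 1) ^ (card S - 1 - card A)) = (\<Sum>i<card S. x ^ i)"
  using assms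
proof (induction S rule: finite_induct)
  case (insert a S)
  have fin: "finite A" "a \<notin> A" if "A \<in> Pow S" for A
    using that insert by (auto intro: finite_subset)
  have inj: "inj_on (insert a) (Pow S - {S})"
    using insert(2) by (auto simp: inj_on_def)
  have "Pow (insert a S) - {insert a S} = Pow S \<union> insert a ` (Pow S - {S})"
    using insert(2) unfolding Pow_insert by (auto simp: insert_ident)
  moreover have "Pow S \<inter> insert a ` (Pow S - {S}) = {}"
    using insert(2) by auto
  ultimately have "(\<Sum>A\<in>Pow (insert a S) - {insert a S}. (x - 1) ^ (card (insert a S) - 1 - card A)) =
      (\<Sum>A\<in>Pow S. (x - 1) ^ (card S - card A)) +
      (\<Sum>A\<in>Pow S - {S}. (x - 1) ^ (card S - 1 - card A))"
    using insert fin by (simp add: sum.union_disjoint sum.reindex[OF inj])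
  then show ?case
    using insert by (simp add: sum_Pow_power_diff_card add.commute)
qed simp

section \<open>Direct sums\<close>

lemma independence_system_direct_sum:
  assumes "independence_system M" "independence_system N"
  shows "independence_system (M \<oplus>\<^sub>M N)"
proof -
  interpret M: independence_system M by fact
  interpret N: independence_system N by fact
  show ?thesis
    using M.indep_subset_ground N.indep_subset_ground
    by unfold_locales
      (auto simp: direct_sum_def M.finite_ground N.finite_ground Plus_subset_Plus_iff
        intro!: exI[of _ "{}"] M.indep_empty N.indep_empty)
qed

lemma rank_direct_sum:
  assumes "independence_system M" "independence_system N"
  shows "rank (M \<oplus>\<^sub>M N) (A <+> B) = rank M A + rank N B"
proof -
  interpret M: independence_system M by fact
  interpret N: independence_system N by fact
  interpret S: independence_system "M \<oplus>\<^sub>M N"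
    using assms by (rule independence_system_direct_sum)
  have card: "card (J <+> K) = card J + card K" if "indep M J" "indep N K" for J K
    using that M.finite_ground M.indep_subset_ground N.finite_ground N.indep_subset_ground
    by (metis card_Plus finite_subset)
  obtain J K where J: "J \<subseteq> A" "indep M J" "card J = rank M A"
    and K: "K \<subseteq> B" "indep N K" "card K = rank N B"
    by (metis M.rank_witness N.rank_witness)
  show ?thesis
  proof (rule S.rank_eqI[of _ _ "J <+> K"])
    fix I assume "I \<subseteq> A <+> B" "indep (M \<oplus>\<^sub>M N) I"
    then obtain J' K' where "I = J' <+> K'" "indep M J'" "indep N K'" "J' \<subseteq> A" "K' \<subseteq> B"
      by (auto simp: direct_sum_def Plus_subset_Plus_iff)
    then show "card I \<le> rank M A + rank N B"
      by (simp add: card M.card_le_rank N.card_le_rank add_mono)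
  qed (use J K card in \<open>auto simp: direct_sum_def\<close>)
qed

text \<open>Rank and cardinality are additive over \<open><+>\<close>, so every summand factors and
  the double sum is a product.\<close>

theorem tutte_direct_sum:
  assumes "independence_system M" "independence_system N"
  shows "tutte (M \<oplus>\<^sub>M N) = tutte M * tutte N"
proof -
  interpret M: independence_system M by fact
  interpret N: independence_system N by fact
  have "(var_x - 1) ^ (rank M (ground M) + rank N (ground N) - (rank M A + rank N B)) *
        (var_y - 1) ^ (card (A <+> B) - (rank M A + rank N B)) =
      (var_x - 1) ^ (rank M (ground M) - rank M A) * (var_y - 1) ^ (card A - rank M A) *
      ((var_x - 1) ^ (rank N (ground N) - rank N B) * (var_y - 1) ^ (card B - rank N B))"
    if "A \<subseteq> ground M" "B \<subseteq> ground N" for A B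
  proof -
    have fin: "finite A" "finite B"
      using that M.finite_ground N.finite_ground by (auto intro: finite_subset)
    \<comment> \<open>Truncated subtraction respects these sums because each rank is at most the
      full rank and at most the cardinality.\<close>
    have eq: "rank M (ground M) + rank N (ground N) - (rank M A + rank N B) =
        (rank M (ground M) - rank M A) + (rank N (ground N) - rank N B)"
      "card (A <+> B) - (rank M A + rank N B) = (card A - rank M A) + (card B - rank N B)"
      using M.rank_mono[OF that(1)] N.rank_mono[OF that(2)]
        M.rank_le_card[OF fin(1)] N.rank_le_card[OF fin(2)] fin
      by (simp_all add: card_Plus)
    show ?thesis unfolding eq power_add by (simp add: mult_ac)
  qed
  moreover have "ground (M \<oplus>\<^sub>M N) = ground M <+> ground N"
    by (simp add: direct_sum_def)
  ultimately show ?thesis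
    unfolding tutte_def sum_product
    by (simp add: sum_Pow_Plus rank_direct_sum[OF assms])
qed

section \<open>The point and the circuit\<close>

lemma independence_system_point_matroid: "independence_system (point_matroid p)"
  by unfold_locales (auto simp: point_matroid_def)

lemma tutte_point_matroid: "tutte (point_matroid p) = var_x"
proof -
  interpret independence_system "point_matroid p"
    by (rule independence_system_point_matroid)
  have r0: "rank (point_matroid p) {} = 0"
    by (rule rank_eqI[of _ _ "{}"]) (auto simp: point_matroid_def)
  have r1: "rank (point_matroid p) {p} = 1"
    by (rule rank_eqI[of _ _ "{p}"]) (auto simp: point_matroid_def subset_singleton_iff)
  have g: "ground (point_matroid p) = {p}" by (simp add: point_matroid_def)
  \<comment> \<open>The empty set contributes x - 1 and \<open>{p}\<close> contributes 1.\<close>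
  show ?thesis
    unfolding tutte_def g using r0 r1 by (simp add: sum_Pow_insert)
qed

lemma independence_system_cycle_matroid:
  assumes "n \<ge> 1"
  shows "independence_system (cycle_matroid n)"
  using assms by unfold_locales (auto simp: cycle_matroid_def of_circuits_def)

lemma tutte_cycle_matroid:
  assumes "n \<ge> 1"
  shows "tutte (cycle_matroid n) = (\<Sum>i = 1..n - 1. var_x ^ i) + var_y"
proof -
  interpret independence_system "cycle_matroid n"
    using assms by (rule independence_system_cycle_matroid)
  have g: "ground (cycle_matroid n) = {1..n}"
    by (simp add: cycle_matroid_def of_circuits_def)
  have r: "rank (cycle_matroid n) A = card A" if "A \<in> Pow {1..n} - {{1..n}}" for A
  proof (rule rank_eqI[of _ _ A])
    have "finite A" using that by (auto intro: finite_subset)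
    then show "card I \<le> card A" if "I \<subseteq> A" for I
      using that by (rule card_mono)
  qed (use that in \<open>auto simp: cycle_matroid_def of_circuits_def\<close>)
  \<comment> \<open>The whole circuit has corank 0 and nullity 1; all other subsets are independent
    and have nullity 0.\<close>
  have "tutte (cycle_matroid n) = (var_x - 1) ^ 0 * (var_y - 1) ^ 1 +
      (\<Sum>A\<in>Pow {1..n} - {{1..n}}. (var_x - 1) ^ (card {1..n} - 1 - card A))"
    unfolding tutte_def g using assms
    by (subst sum.remove[of _ "{1..n}"]) (auto simp: rank_cycle_matroid r simp del: One_nat_def)
  also have "\<dots> = var_y - 1 + (\<Sum>i<n. var_x ^ i)"
    by (subst sum_psubsets_power_diff_card) auto
  \<comment> \<open>The constant term of the geometric sum cancels the -1 in
    \<open>var_y - 1\<close>.\<close>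
  also have "{..<n} = insert 0 {1..n - 1}"
    using assms by auto
  finally show ?thesis by simp
qed

section \<open>Contraction of a non-loop\<close>

text \<open>A maximum independent set can be chosen through e: take a largest one among those
  containing e; were it smaller than the rank, augmentation would enlarge it while keeping
  e.\<close>

lemma (in matroid) rank_insert_witness:
  assumes "indep M {e}"
  obtains J where "J \<subseteq> insert e A" "e \<in> J" "indep M J" "card J = rank M (insert e A)"
proof -
  define \<J> where "\<J> = {J. J \<subseteq> insert e A \<and> e \<in> J \<and> indep M J}"
  have "finite \<J>" "{e} \<in> \<J>"
    using finite_indep_sets[of "insert e A"] assms by (auto simp: \<J>_def elim: rev_finite_subset)
  then have "Max (card ` \<J>) \<in> card ` \<J>"
    by (intro Max_in) auto
  then obtain J where J: "J \<in> \<J>" "card J = Max (card ` \<J>)"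
    by auto
  have max: "card K \<le> card J" if "K \<in> \<J>" for K
    using that \<open>finite \<J>\<close> J(2) by simp
  have finJ: "finite J"
    using J finite_ground indep_subset_ground by (auto simp: \<J>_def intro: finite_subset)
  obtain I where I: "I \<subseteq> insert e A" "indep M I" "card I = rank M (insert e A)"
    by (rule rank_witness)
  have "\<not> card J < card I"
  proof
    assume "card J < card I"
    then obtain f where f: "f \<in> I - J" "indep M (insert f J)"
      using indep_augment[of J I] J I by (auto simp: \<J>_def)
    then have "insert f J \<in> \<J>" using J I by (auto simp: \<J>_def)
    from max[OF this] f finJ show False by simp
  qed
  moreover have "card J \<le> rank M (insert e A)"
    using J by (intro card_le_rank) (auto simp: \<J>_def)
  ultimately show ?thesis
    using J I by (intro that[of J]) (auto simp: \<J>_def)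
qed

lemma (in matroid) independence_system_contract: "independence_system (contract M e)"
  using finite_ground indep_empty
  by unfold_locales (auto simp: contract_def)

text \<open>Adding e turns independent sets of the contraction into independent sets of M through e,
  one element larger, and some maximum independent set of \<open>insert e A\<close> passes through
  e.\<close>

lemma (in matroid) rank_contract:
  assumes "indep M {e}" "A \<subseteq> ground M - {e}"
  shows "rank M (insert e A) = Suc (rank (contract M e) A)"
proof -
  interpret C: independence_system "contract M e"
    by (rule independence_system_contract)
  have fin: "finite A"
    using assms(2) finite_ground by (auto intro: finite_subset)
  have ind: "indep (contract M e) I \<longleftrightarrow> indep M (insert e I)" if "I \<subseteq> A" for I
    using that assms by (auto simp: contract_def)
  obtain J where J: "J \<subseteq> insert e A" "e \<in> J" "indep M J" "card J = rank M (insert e A)"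
    using rank_insert_witness[OF assms(1)] by blast
  have finJ: "finite J" using J(1) fin by (auto intro: finite_subset)
  have "rank (contract M e) A = rank M (insert e A) - 1"
  proof (rule C.rank_eqI[of _ _ "J - {e}"])
    fix I assume I: "I \<subseteq> A" "indep (contract M e) I"
    then have "card (insert e I) \<le> rank M (insert e A)"
      using ind by (intro card_le_rank) auto
    moreover have "card (insert e I) = Suc (card I)"
      using I assms(2) fin by (intro card_insert_disjoint) (auto intro: finite_subset)
    ultimately show "card I \<le> rank M (insert e A) - 1" by simp
  next
    have "J - {e} \<subseteq> A" using J by auto
    moreover from this show "indep (contract M e) (J - {e})"
      using J by (simp add: ind insert_absorb)
    ultimately show "J - {e} \<subseteq> A" by simp
    show "card (J - {e}) = rank M (insert e A) - 1"
      using J finJ by (simp add: card_Diff_singleton)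
  qed
  \<comment> \<open>This makes the subtraction of 1 exact.\<close>
  moreover have "rank M (insert e A) \<ge> 1"
    using card_le_rank[OF assms(1), of "insert e A"] by simp
  ultimately show ?thesis by simp
qed

section \<open>Attaching a circuit at an element\<close>

text \<open>The parallel connection of \<open>M\<close> with a circuit on \<open>S \<union> {e}\<close>, on a ground set without
  equivalence classes.\<close>

definition attach_circuit :: "'b set \<Rightarrow> 'a indep_system \<Rightarrow> 'a \<Rightarrow> ('b + 'a) indep_system" where
  "attach_circuit S M e =
    \<lparr>ground = S <+> ground M,
     indep = (\<lambda>I. \<exists>L B. I = L <+> B \<and> L \<subseteq> S \<and> indep M B \<and>
       (L = S \<longrightarrow> e \<notin> B \<and> indep M (insert e B)))\<rparr>"

text \<open>The two parts of a \<open><+>\<close> are unique, so the existential disappears. A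
  complete S acts as a copy of e: e would close the circuit, and S can replace e in any circuit of
  M.\<close>

lemma indep_attach_circuit:
  "indep (attach_circuit S M e) (L <+> B) \<longleftrightarrow>
    L \<subseteq> S \<and> indep M B \<and> (L = S \<longrightarrow> e \<notin> B \<and> indep M (insert e B))"
  by (auto simp: attach_circuit_def Plus_eq_iff)

context matroid
begin

lemma independence_system_attach_circuit:
  assumes "finite S" "S \<noteq> {}"
  shows "independence_system (attach_circuit S M e)"
proof
  \<comment> \<open>As S is nonempty, the clause for \<open>L = S\<close> is vacuous here.\<close>
  have "indep (attach_circuit S M e) ({} <+> {})"
    unfolding indep_attach_circuit using assms indep_empty by auto
  then show "indep (attach_circuit S M e) {}" by (simp add: Plus_def)
qed (use assms finite_ground indep_subset_ground in
    \<open>auto simp: attach_circuit_def Plus_subset_Plus_iff\<close>)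

text \<open>With part of S missing the new circuit imposes nothing, and L adds as a set of
  coloops.\<close>

lemma rank_attach_circuit_psubset:
  assumes "finite S" "L \<subset> S" "B \<subseteq> ground M"
  shows "rank (attach_circuit S M e) (L <+> B) = card L + rank M B"
proof -
  interpret Q: independence_system "attach_circuit S M e"
    using assms by (intro independence_system_attach_circuit) auto
  have fin: "finite L" "finite B"
    using assms finite_ground by (auto intro: finite_subset)
  obtain K where K: "K \<subseteq> B" "indep M K" "card K = rank M B"
    by (rule rank_witness)
  show ?thesis
  proof (rule Q.rank_eqI[of _ _ "L <+> K"])
    fix I assume "I \<subseteq> L <+> B" and I: "indep (attach_circuit S M e) I"
    then obtain L' B' where sub: "I = L' <+> B'" "L' \<subseteq> L" "B' \<subseteq> B"
      by (blast elim: subset_PlusE)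
    then have "indep M B'" using I by (simp add: indep_attach_circuit)
    then show "card I \<le> card L + rank M B"
      using sub fin card_le_rank[of B' B] card_mono[of L L']
      by (simp add: card_Plus finite_subset add_mono)
  qed (use K fin assms in \<open>auto simp: indep_attach_circuit Plus_subset_Plus_iff card_Plus finite_subset\<close>)
qed

text \<open>An independent set either omits an element of S, or keeps S and then leaves room for e
  in its other part; each choice costs one. The bound is attained by S with a maximum independent
  set of \<open>insert e B\<close> through e, from which e is removed.\<close>

lemma rank_attach_circuit_full:
  assumes "finite S" "S \<noteq> {}" "indep M {e}" "B \<subseteq> ground M"
  shows "rank (attach_circuit S M e) (S <+> B) = card S - 1 + rank M (insert e B)"
proof -
  interpret Q: independence_system "attach_circuit S M e"
    using assms(1,2) by (rule independence_system_attach_circuit)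
  have fin: "finite B"
    using assms finite_ground by (auto intro: finite_subset)
  have S: "card S > 0"
    using assms by (simp add: card_gt_0_iff)
  obtain J where J: "J \<subseteq> insert e B" "e \<in> J" "indep M J" "card J = rank M (insert e B)"
    using rank_insert_witness[OF assms(3)] by blast
  have finJ: "finite J" using J(1) fin by (auto intro: finite_subset)
  have J': "card J > 0" using finJ J(2) by (auto simp: card_gt_0_iff)
  show ?thesis
  proof (rule Q.rank_eqI[of _ _ "S <+> (J - {e})"])
    fix I assume "I \<subseteq> S <+> B" and I: "indep (attach_circuit S M e) I"
    then obtain L' B' where sub: "I = L' <+> B'" "L' \<subseteq> S" "B' \<subseteq> B"
      by (blast elim: subset_PlusE)
    have fin': "finite L'" "finite B'"
      using sub assms fin by (auto intro: finite_subset)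
    have c: "card I = card L' + card B'"
      using sub fin' by (simp add: card_Plus)
    show "card I \<le> card S - 1 + rank M (insert e B)"
    proof (cases "L' = S")
      case True
      then have "e \<notin> B'" "indep M (insert e B')"
        using I sub by (simp_all add: indep_attach_circuit)
      then have "Suc (card B') \<le> rank M (insert e B)"
        using card_le_rank[of "insert e B'" "insert e B"] sub fin' by auto
      then show ?thesis using c True S by simp
    next
      case False
      then have "card L' < card S"
        using sub assms by (intro psubset_card_mono) auto
      moreover have "card B' \<le> rank M (insert e B)"
        using I sub by (intro card_le_rank) (auto simp: indep_attach_circuit)
      ultimately show ?thesis using c by simp
    qed
  next
    show "indep (attach_circuit S M e) (S <+> (J - {e}))"
      using J indep_mono[of J "J - {e}"] by (auto simp: indep_attach_circuit insert_absorb)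
    show "card (S <+> (J - {e})) = card S - 1 + rank M (insert e B)"
      using J J' finJ S assms(1) by (simp add: card_Plus card_Diff_singleton)
  qed (use J in auto)
qed

theorem tutte_attach_circuit:
  assumes "finite S" "S \<noteq> {}" "indep M {e}"
  shows "tutte (attach_circuit S M e) =
    (\<Sum>i<card S. var_x ^ i) * tutte M + var_y * tutte (contract M e)"
proof -
  interpret C: independence_system "contract M e"
    by (rule independence_system_contract)
  define E where "E = ground M"
  define E' where "E' = ground M - {e}"
  define R where "R = rank M E"
  have e: "e \<in> E" using indep_subset_ground[OF assms(3)] by (simp add: E_def)
  have E: "E = insert e E'" "e \<notin> E'" "finite E'"
    using e finite_ground by (auto simp: E_def E'_def)
  have gC: "ground (contract M e) = E'"
    by (simp add: contract_def E'_def)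
  have S: "card S > 0"
    using assms by (simp add: card_gt_0_iff)
  have full: "rank (attach_circuit S M e) (S <+> E) = card S - 1 + R"
    using rank_attach_circuit_full[OF assms, of E] e by (simp add: E_def R_def insert_absorb)
  \<comment> \<open>The summand at \<open>A <+> B\<close>, with the full rank already
    evaluated.\<close>
  define t where "t A B = (var_x - 1) ^ (card S - 1 + R - rank (attach_circuit S M e) (A <+> B)) *
    (var_y - 1) ^ (card (A <+> B) - rank (attach_circuit S M e) (A <+> B))" for A B
  have proper: "(\<Sum>B\<in>Pow E. t L B) = (var_x - 1) ^ (card S - 1 - card L) * tutte M"
    if "L \<in> Pow S - {S}" for L
  proof -
    have L: "L \<subset> S" "finite L" using that assms by (auto intro: finite_subset)
    have cL: "card L < card S" using L assms by (intro psubset_card_mono)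
    have "t L B = (var_x - 1) ^ (card S - 1 - card L) *
        ((var_x - 1) ^ (R - rank M B) * (var_y - 1) ^ (card B - rank M B))" if "B \<subseteq> E" for B
    proof -
      have r: "rank (attach_circuit S M e) (L <+> B) = card L + rank M B"
        using that L assms by (intro rank_attach_circuit_psubset) (auto simp: E_def)
      have "finite B" using that finite_ground by (auto simp: E_def intro: finite_subset)
      then have c: "card (L <+> B) - (card L + rank M B) = card B - rank M B"
        using L by (simp add: card_Plus)
      \<comment> \<open>The corank splits exactly because L has at most \<open>card S - 1\<close>
        elements.\<close>
      have "card S - 1 + R - (card L + rank M B) = (card S - 1 - card L) + (R - rank M B)"
        using rank_mono[OF that] cL by (simp add: R_def)
      then show ?thesis unfolding t_def r c by (simp add: power_add mult_ac)
    qed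
    then show ?thesis
      unfolding tutte_def by (simp add: sum_distrib_left E_def R_def)
  qed
  define u where "u B = (var_x - 1) ^ (rank (contract M e) E' - rank (contract M e) B) *
    (var_y - 1) ^ (card B - rank (contract M e) B)" for B
  have R: "R = Suc (rank (contract M e) E')"
    using rank_contract[OF assms(3), of E'] by (simp add: R_def E E'_def)
  \<comment> \<open>Given S, the element e adds no rank: it leaves the corank unchanged and raises
    the nullity by one, hence the factor \<open>var_y - 1\<close>.\<close>
  have t: "t S B = u B" "t S (insert e B) = (var_y - 1) * u B" if "B \<subseteq> E'" for B
  proof -
    have fin: "finite B" "e \<notin> B" using that E by (auto intro: finite_subset)
    have r: "rank M (insert e B) = Suc (rank (contract M e) B)"
      using that assms by (intro rank_contract) (auto simp: E'_def)
    have "B \<subseteq> ground M" "insert e B \<subseteq> ground M"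
      using that e by (auto simp: E'_def E_def)
    then have q: "rank (attach_circuit S M e) (S <+> B) = card S + rank (contract M e) B"
      "rank (attach_circuit S M e) (S <+> insert e B) = card S + rank (contract M e) B"
      using S by (simp_all add: rank_attach_circuit_full assms r)
    have le: "rank (contract M e) B \<le> card B"
      using fin by (intro C.rank_le_card)
    have s: "card S - 1 + R = card S + rank (contract M e) E'"
      using S R by simp
    show "t S B = u B" "t S (insert e B) = (var_y - 1) * u B"
      using assms(1) fin le unfolding t_def s
      by (simp_all add: u_def q card_Plus Suc_diff_le mult_ac)
  qed
  have "(\<Sum>B\<in>Pow E. t S B) = (\<Sum>B\<in>Pow E'. u B) + (\<Sum>B\<in>Pow E'. (var_y - 1) * u B)"
    unfolding E(1) using E t by (simp add: sum_Pow_insert)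
  also have "\<dots> = var_y * (\<Sum>B\<in>Pow E'. u B)"
    unfolding sum_distrib_left[symmetric] by (simp add: algebra_simps)
  also have "\<dots> = var_y * tutte (contract M e)"
    by (simp add: tutte_def gC u_def)
  finally have top: "(\<Sum>B\<in>Pow E. t S B) = var_y * tutte (contract M e)" .
  have "tutte (attach_circuit S M e) = (\<Sum>A\<in>Pow S. \<Sum>B\<in>Pow E. t A B)"
  proof -
    have "ground (attach_circuit S M e) = S <+> E" by (simp add: attach_circuit_def E_def)
    then show ?thesis unfolding tutte_def by (simp only: full sum_Pow_Plus t_def)
  qed
  also have "\<dots> = var_y * tutte (contract M e) +
      (\<Sum>A\<in>Pow S - {S}. (var_x - 1) ^ (card S - 1 - card A) * tutte M)"
    using assms by (subst sum.remove[of _ S]) (auto simp: top proper)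
  finally show ?thesis
    unfolding sum_distrib_right[symmetric] sum_psubsets_power_diff_card[OF assms(1)]
    by (simp add: add.commute)
qed

section \<open>Circuits and the parallel connection\<close>

lemma dependent_contains_circuit:
  assumes "A \<subseteq> ground M" "\<not> indep M A"
  shows "\<exists>C\<in>circuits M. C \<subseteq> A"
proof -
  have "finite A" using assms(1) finite_ground by (rule finite_subset)
  then show ?thesis using assms
  proof (induction A rule: finite_psubset_induct)
    case (psubset A)
    show ?case
    proof (cases "\<forall>D. D \<subset> A \<longrightarrow> indep M D")
      case True
      then show ?thesis using psubset.prems by (auto simp: circuits_def)
    next
      case False
      then obtain D where "D \<subset> A" "\<not> indep M D" by blast
      then show ?thesis using psubset.IH[of D] psubset.prems by blast
    qed
  qed
qed

lemma indep_iff_no_circuit: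
  assumes "A \<subseteq> ground M"
  shows "indep M A \<longleftrightarrow> (\<forall>C\<in>circuits M. \<not> C \<subseteq> A)"
proof
  assume "indep M A"
  then show "\<forall>C\<in>circuits M. \<not> C \<subseteq> A"
    using indep_mono unfolding circuits_def by blast
qed (use dependent_contains_circuit[OF assms] in blast)

text \<open>A circuit inside \<open>{e}\<close> would be empty or a loop. This puts the contraction
  by e in the non-loop case.\<close>

lemma simple_imp_indep_singleton:
  assumes "simple M" "e \<in> ground M"
  shows "indep M {e}"
proof (rule ccontr)
  assume "\<not> indep M {e}"
  then obtain C where "C \<in> circuits M" "C \<subseteq> {e}"
    using dependent_contains_circuit[of "{e}"] assms(2) by blast
  then show False
    using assms(1) indep_empty by (auto simp: simple_def circuits_def subset_singleton_iff)
qed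

text \<open>Every class has exactly one representative other than \<open>Inl 1\<close>, with e
  standing for the merged class. The circuits become \<open>{2..n} <+> {e}\<close>, the circuits C
  of M, and \<open>{2..n} <+> (C - {e})\<close> for C through e.\<close>

lemma parallel_connection_iso:
  assumes "n \<ge> 2" "e \<in> ground M"
  defines "f \<equiv> \<lambda>q. identify n M e `` {q}"
  shows "bij_betw f (ground (attach_circuit {2..n} M e)) (ground (parallel_connection n M e))"
    and "\<And>I. I \<subseteq> ground (attach_circuit {2..n} M e) \<Longrightarrow>
      indep (parallel_connection n M e) (f ` I) \<longleftrightarrow> indep (attach_circuit {2..n} M e) I"
proof -
  define D where "D = {2..n} <+> ground M"
  have gD: "ground (attach_circuit {2..n} M e) = D"
    by (simp add: attach_circuit_def D_def)
  have f1: "f (Inl 1) = f (Inr e)"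
    using assms by (auto simp: f_def identify_def)
  have inj: "inj_on f D"
  proof (rule inj_onI)
    fix q q' assume q: "q \<in> D" "q' \<in> D" "f q = f q'"
    have "q \<in> f q" using q(1) by (auto simp: f_def identify_def D_def)
    then have "(q', q) \<in> identify n M e" unfolding q(3) by (simp add: f_def)
    \<comment> \<open>Distinct related elements always include \<open>Inl 1\<close>, which is not in
      D.\<close>
    moreover have "q \<noteq> Inl 1" "q' \<noteq> Inl 1" using q by (auto simp: D_def)
    ultimately show "q = q'" by (auto simp: identify_def)
  qed
  have Icc: "{1..n} = insert 1 {2..n}"
    using assms(1) by auto
  have "f ` ({1..n} <+> ground M) = f ` D"
    using f1 assms(2) unfolding D_def Icc Plus_def image_Un image_insert by blast
  moreover have "ground (parallel_connection n M e) = f ` ({1..n} <+> ground M)"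
    unfolding parallel_connection_def of_circuits_def quotient_def f_def by auto
  ultimately have gP: "ground (parallel_connection n M e) = f ` D" by simp
  show "bij_betw f (ground (attach_circuit {2..n} M e)) (ground (parallel_connection n M e))"
    unfolding gD gP using inj by (simp add: bij_betw_def)
  fix I assume "I \<subseteq> ground (attach_circuit {2..n} M e)"
  then obtain L B where I: "I = L <+> B" "L \<subseteq> {2..n}" "B \<subseteq> ground M"
    unfolding gD D_def by (rule subset_PlusE)
  \<comment> \<open>By injectivity on D, inclusion between images can be tested separately in the
    two parts.\<close>
  have sub: "f ` (X <+> Y) \<subseteq> f ` (L <+> B) \<longleftrightarrow> X \<subseteq> L \<and> Y \<subseteq> B"
    if "X \<subseteq> {2..n}" "Y \<subseteq> ground M" for X Y
  proof -
    have "X <+> Y \<subseteq> D" "L <+> B \<subseteq> D"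
      using that I by (auto simp: D_def)
    then have "f ` (X <+> Y) \<subseteq> f ` (L <+> B) \<longleftrightarrow> X <+> Y \<subseteq> L <+> B"
      by (rule inj_on_image_subset_iff[OF inj])
    then show ?thesis by (simp only: Plus_subset_Plus_iff)
  qed
  have c: "C \<subseteq> ground M" if "C \<in> circuits M" for C
    using that by (auto simp: circuits_def)
  \<comment> \<open>The element 1 of the circuit is represented by e.\<close>
  have cl: "classes n M e (Inl ` {1..n}) = f ` ({2..n} <+> {e})"
    using f1 unfolding classes_def f_def[symmetric] Icc image_insert Plus_def image_Un by auto
  have cr: "classes n M e (Inr ` C) = f ` ({} <+> C)" for C
    by (simp add: classes_def f_def Plus_def)
  have "{1..n} - {1} = {2..n}" by auto
  then have cu: "classes n M e (Inl ` ({1..n} - {1})) \<union> classes n M e (Inr ` (C - {e})) =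
      f ` ({2..n} <+> (C - {e}))" for C
    unfolding classes_def f_def Plus_def image_Un by simp
  have "1 \<in> {1..n}" using assms(1) by simp
  then have pc: "parallel_circuits n M e = {f ` ({2..n} <+> {e})} \<union>
      (\<lambda>C. f ` ({} <+> C)) ` circuits M \<union>
      (\<lambda>C. f ` ({2..n} <+> (C - {e}))) ` {C \<in> circuits M. e \<in> C}"
    unfolding parallel_circuits_def circuits_cycle_matroid cl[symmetric] cr[symmetric] cu[symmetric]
    by blast
  have "indep (parallel_connection n M e) (f ` I) \<longleftrightarrow>
      (\<forall>C\<in>parallel_circuits n M e. \<not> C \<subseteq> f ` (L <+> B))"
    using gP I by (auto simp: parallel_connection_def of_circuits_def D_def)
  also have "\<dots> \<longleftrightarrow> \<not> f ` ({2..n} <+> {e}) \<subseteq> f ` (L <+> B) \<and>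
      (\<forall>C\<in>circuits M. \<not> f ` ({} <+> C) \<subseteq> f ` (L <+> B)) \<and>
      (\<forall>C\<in>{C \<in> circuits M. e \<in> C}. \<not> f ` ({2..n} <+> (C - {e})) \<subseteq> f ` (L <+> B))"
    unfolding pc by (simp only: ball_Un ball_simps conj_assoc simp_thms)
  also have "\<dots> \<longleftrightarrow> \<not> ({2..n} \<subseteq> L \<and> e \<in> B) \<and> (\<forall>C\<in>circuits M. \<not> C \<subseteq> B) \<and>
      (\<forall>C\<in>circuits M. e \<in> C \<longrightarrow> \<not> ({2..n} \<subseteq> L \<and> C - {e} \<subseteq> B))"
  proof -
    have "f ` ({2..n} <+> {e}) \<subseteq> f ` (L <+> B) \<longleftrightarrow> {2..n} \<subseteq> L \<and> e \<in> B"
      using assms(2) by (subst sub) auto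
    moreover have "f ` ({} <+> C) \<subseteq> f ` (L <+> B) \<longleftrightarrow> C \<subseteq> B"
      "f ` ({2..n} <+> (C - {e})) \<subseteq> f ` (L <+> B) \<longleftrightarrow> {2..n} \<subseteq> L \<and> C - {e} \<subseteq> B"
      if "C \<in> circuits M" for C
      using c[OF that] by (subst sub; auto)+
    ultimately show ?thesis by auto
  qed
  \<comment> \<open>For C through e, \<open>C - {e} \<subseteq> B\<close> says
    \<open>C \<subseteq> insert e B\<close>; a circuit avoiding e lies in \<open>insert e B\<close>
    only if it lies in B.\<close>
  also have "\<dots> \<longleftrightarrow> (\<forall>C\<in>circuits M. \<not> C \<subseteq> B) \<and>
      (L = {2..n} \<longrightarrow> e \<notin> B \<and> (\<forall>C\<in>circuits M. \<not> C \<subseteq> insert e B))"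
    using I(2) by blast
  also have "\<dots> \<longleftrightarrow> indep (attach_circuit {2..n} M e) I"
    using I assms(2) by (simp add: indep_attach_circuit indep_iff_no_circuit)
  finally show "indep (parallel_connection n M e) (f ` I) \<longleftrightarrow>
      indep (attach_circuit {2..n} M e) I" .
qed

text \<open>Finiteness and independence of the empty set are carried over by the bijection, so the
  product formula covers the sum with the point.\<close>

lemma independence_system_parallel_connection:
  assumes "n \<ge> 2" "e \<in> ground M"
  shows "independence_system (parallel_connection n M e)"
proof -
  interpret Q: independence_system "attach_circuit {2..n} M e"
    using assms by (intro independence_system_attach_circuit) auto
  show ?thesis
    using bij_betw_finite[OF parallel_connection_iso(1)[OF assms]] Q.finite_ground
      parallel_connection_iso(2)[OF assms, of "{}"] Q.indep_empty
    by unfold_locales (auto simp: parallel_connection_def of_circuits_def)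
qed

lemma tutte_parallel_connection:
  assumes "n \<ge> 2" "e \<in> ground M"
  shows "tutte (parallel_connection n M e) = tutte (attach_circuit {2..n} M e)"
  using parallel_connection_iso[OF assms] by (rule tutte_iso)

end

section \<open>Tutte polynomials of the two direct sums\<close>

theorem theorem4p4:
  fixes n :: nat and M\<^sub>0 :: "'a indep_system" and \<epsilon>\<^sub>0 :: 'a and p :: 'b
  assumes "n \<ge> 2"
    and "matroid M\<^sub>0" and "simple M\<^sub>0"
    and "\<epsilon>\<^sub>0 \<in> ground M\<^sub>0"
  shows "tutte (cycle_matroid n \<oplus>\<^sub>M M\<^sub>0) = ((\<Sum>i = 1..n - 1. var_x ^ i) + var_y) * tutte M\<^sub>0 \<and>
    tutte (parallel_connection n M\<^sub>0 \<epsilon>\<^sub>0 \<oplus>\<^sub>M point_matroid p) =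
      (\<Sum>i = 1..n - 1. var_x ^ i) * tutte M\<^sub>0 + var_x * var_y * tutte (contract M\<^sub>0 \<epsilon>\<^sub>0)"
proof
  interpret matroid M\<^sub>0 by fact
  have n: "n \<ge> 1" using assms(1) by simp
  show "tutte (cycle_matroid n \<oplus>\<^sub>M M\<^sub>0) = ((\<Sum>i = 1..n - 1. var_x ^ i) + var_y) * tutte M\<^sub>0"
    using tutte_direct_sum[OF independence_system_cycle_matroid[OF n] independence_system_axioms]
    by (simp only: tutte_cycle_matroid[OF n])
  have "tutte (parallel_connection n M\<^sub>0 \<epsilon>\<^sub>0 \<oplus>\<^sub>M point_matroid p) =
      tutte (attach_circuit {2..n} M\<^sub>0 \<epsilon>\<^sub>0) * var_x"
    using assms independence_system_parallel_connection tutte_parallel_connection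
    by (simp add: tutte_direct_sum independence_system_point_matroid tutte_point_matroid)
  \<comment> \<open>The range \<open>i < n - 1\<close> comes from
    \<open>card {2..n} = n - 1\<close>.\<close>
  also have "tutte (attach_circuit {2..n} M\<^sub>0 \<epsilon>\<^sub>0) =
      (\<Sum>i<n - 1. var_x ^ i) * tutte M\<^sub>0 + var_y * tutte (contract M\<^sub>0 \<epsilon>\<^sub>0)"
    using assms simple_imp_indep_singleton tutte_attach_circuit[of "{2..n}" \<epsilon>\<^sub>0] by simp
  also have "\<dots> * var_x = (\<Sum>i<n - 1. var_x ^ Suc i) * tutte M\<^sub>0 +
      var_x * var_y * tutte (contract M\<^sub>0 \<epsilon>\<^sub>0)"
    by (simp add: algebra_simps sum_distrib_left)
  \<comment> \<open>The factor x of the point shifts the exponents 0 to n - 2 up to 1 to n -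
    1.\<close>
  also have "(\<Sum>i<n - 1. var_x ^ Suc i) = (\<Sum>i = 1..n - 1. var_x ^ i)"
    by (rule sum.reindex_bij_witness[of _ "\<lambda>i. i - 1" Suc]) auto
  finally show "tutte (parallel_connection n M\<^sub>0 \<epsilon>\<^sub>0 \<oplus>\<^sub>M point_matroid p) =
      (\<Sum>i = 1..n - 1. var_x ^ i) * tutte M\<^sub>0 + var_x * var_y * tutte (contract M\<^sub>0 \<epsilon>\<^sub>0)" .
qed

end
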